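(* For every constant $k$, no deterministic width-$k$ online bipartite matching algorithm can achieve an asymptotic approximation ratio greater than $1/2$.
   Context: Online one-sided bipartite matching: offline vertices are known in advance; online vertices arrive one at a time in adversarial order, each with its set of offline neighbours, and the algorithm must irrevocably match it to an unmatched neighbour or leave it unmatched; the goal is a maximum-size matching. Width-$k$ model: the algorithm maintains a tree of partial matchings with the empty matching as root at level 0; when the $i$-th online vertex arrives, each node at level $i-1$ gets at least one child (no cutting), each child extending the parent matching by a decision for this vertex; every level contains at most $k$ nodes; the output is the largest matching at the final level. The asymptotic approximation ratio of $\mathbb{A}$ is $\liminf_{n}\inf_{I\in\mathcal{I}_n} v(\mathbb{A},I)/v(I)$, where $\mathcal{I}_n$ are instances of size $n$ and $v(I)$ is the maximum matching size. *)

theory Defs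
  imports Complex_Main "HOL-Library.Extended_Real" "HOL-Library.Liminf_Limsup"
begin

text \<open>Instances of online one-sided bipartite matching.
  An mm_instance is a pair (U, ns): U is the finite set of offline vertices (known in advance),
  ns is the list of online vertices in arrival order, the j-th online vertex being given by
  its set of offline neighbours ns ! j.\<close>

type_synonym mm_instance = "nat set \<times> nat set list"

definition wf_instance :: "mm_instance \<Rightarrow> bool" where
  "wf_instance I \<longleftrightarrow> finite (fst I) \<and> (\<forall>N \<in> set (snd I). N \<subseteq> fst I)"

definition inst_size :: "mm_instance \<Rightarrow> nat" where
  "inst_size I = length (snd I)"

definition instances_of_size :: "nat \<Rightarrow> mm_instance set" where
  "instances_of_size n = {I. wf_instance I \<and> inst_size I = n}"

definition is_matching :: "nat set list \<Rightarrow> (nat \<times> nat) set \<Rightarrow> bool" where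
  "is_matching ns M \<longleftrightarrow>
     M \<subseteq> {(j, u). j < length ns \<and> u \<in> ns ! j} \<and>
     (\<forall>(j, u) \<in> M. \<forall>(j', u') \<in> M. (j = j' \<longleftrightarrow> u = u'))"

definition opt_value :: "mm_instance \<Rightarrow> nat" where
  "opt_value I = Max {card M | M. is_matching (snd I) M}"

text \<open>Deterministic width-k algorithms.  A node of the tree at level i is represented by its
  partial matching, i.e. the list of decisions (None = unmatched, Some u = matched to offline
  vertex u) for online vertices 0..i-1.  A deterministic algorithm is a function which, given the
  offline vertex set and the online vertices revealed so far (a prefix of length i >= 1), returns
  the nodes of level i as a list of pairs (index of the parent node in level i-1, decision for the
  i-th online vertex).  Nodes are indexed, so distinct nodes may carry equal matchings.\<close>

type_synonym algorithm = "nat set \<Rightarrow> nat set list \<Rightarrow> (nat \<times> nat option) list"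

fun tree_level :: "algorithm \<Rightarrow> nat set \<Rightarrow> nat set list \<Rightarrow> nat \<Rightarrow> nat option list list" where
  "tree_level A U ns 0 = [[]]"
| "tree_level A U ns (Suc i) =
     map (\<lambda>(p, d). (tree_level A U ns i ! p) @ [d]) (A U (take (Suc i) ns))"

definition width_alg :: "nat \<Rightarrow> algorithm \<Rightarrow> bool" where
  "width_alg k A \<longleftrightarrow>
    (\<forall>U ns. wf_instance (U, ns) \<longrightarrow>
      (\<forall>i < length ns.
         let L = tree_level A U ns i; C = A U (take (Suc i) ns) in
           length C \<le> k \<and>
           (\<forall>(p, d) \<in> set C. p < length L \<and>
               (case d of None \<Rightarrow> True | Some u \<Rightarrow> u \<in> ns ! i \<and> Some u \<notin> set (L ! p))) \<and>
           (\<forall>p < length L. \<exists>d. (p, d) \<in> set C)))"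

definition matching_size :: "nat option list \<Rightarrow> nat" where
  "matching_size ds = length (filter (\<lambda>d. d \<noteq> None) ds)"

definition alg_value :: "algorithm \<Rightarrow> mm_instance \<Rightarrow> nat" where
  "alg_value A I = Max (matching_size ` set (tree_level A (fst I) (snd I) (length (snd I))))"

definition inst_ratio :: "algorithm \<Rightarrow> mm_instance \<Rightarrow> real" where
  "inst_ratio A I = (if opt_value I = 0 then 1 else real (alg_value A I) / real (opt_value I))"

definition asymptotic_ratio :: "algorithm \<Rightarrow> ereal" where
  "asymptotic_ratio A = liminf (\<lambda>n. INF I \<in> instances_of_size n. ereal (inst_ratio A I))"

end

theory Submission
  imports Defs "HOL-Library.FuncSet"
begin

text \<open>
  The adversary keeps a pool of offline vertices. By pigeonhole, the pool contains more than \<open>k\<close>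
  vertices that are indistinguishable so far, that is, filled in exactly the same tree nodes.
  It presents an online vertex adjacent to such a class and afterwards removes from the pool one
  vertex of the class that no child has chosen, as the partner of the online vertex in the optimum.
  If a node had filled the whole class, it cannot match the online vertex; otherwise it never fills
  the partner. So each branch covers at most one endpoint of every edge of the optimum, and
  only boundedly many offline vertices lie outside the optimum.
\<close>

text \<open>Each level is computed from a prefix of the arrivals, so the adversary may append
  vertices without disturbing the tree built so far.\<close>

lemma tree_level_append:
  "i \<le> length ns \<Longrightarrow> tree_level A U (ns @ ms) i = tree_level A U ns i"
  by (induction i) auto

lemma width_algD:
  assumes "width_alg k A" "wf_instance (U, ns)" "i < length ns"
  shows "length (A U (take (Suc i) ns)) \<le> k"
    and "(p, d) \<in> set (A U (take (Suc i) ns)) \<Longrightarrow> p < length (tree_level A U ns i)"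
    and "(p, Some u) \<in> set (A U (take (Suc i) ns)) \<Longrightarrow>
      u \<in> ns ! i \<and> Some u \<notin> set (tree_level A U ns i ! p)"
    and "p < length (tree_level A U ns i) \<Longrightarrow> \<exists>d. (p, d) \<in> set (A U (take (Suc i) ns))"
  using assms unfolding width_alg_def Let_def by fastforce+

text \<open>The width condition speaks only of levels after the root; \<open>Suc k\<close> also
  covers the single root for every \<open>k\<close>.\<close>

lemma length_tree_level_le:
  assumes "width_alg k A" "wf_instance (U, ns)" "i \<le> length ns"
  shows "length (tree_level A U ns i) \<le> Suc k"
proof (cases i)
  case (Suc j)
  with width_algD(1)[OF assms(1,2), of j] assms(3) show ?thesis by simp
qed simp

text \<open>Since every node has a child, no level dies out. This ensures that the
  \<open>Max\<close> in \<open>alg_value\<close> is attained.\<close>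

lemma tree_level_nonempty:
  assumes "width_alg k A" "wf_instance (U, ns)" "i \<le> length ns"
  shows "tree_level A U ns i \<noteq> []"
  using assms(3)
proof (induction i)
  case (Suc i)
  then show ?case
    using width_algD(4)[OF assms(1,2), of i 0] by auto
qed simp

definition filled :: "nat option list \<Rightarrow> nat set" where
  "filled ds = {u. Some u \<in> set ds}"

lemma filled_simps [simp]:
  "filled [] = {}"
  "filled (ds @ [None]) = filled ds"
  "filled (ds @ [Some u]) = insert u (filled ds)"
  by (auto simp: filled_def)

lemma finite_filled [simp]: "finite (filled ds)"
proof -
  have "Some ` filled ds \<subseteq> set ds" by (auto simp: filled_def)
  then have "finite (Some ` filled ds)" by (rule finite_subset) simp
  then show ?thesis by (rule finite_imageD) simp
qed

lemma matching_size_simps [simp]: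
  "matching_size [] = 0"
  "matching_size (ds @ [None]) = matching_size ds"
  "matching_size (ds @ [Some u]) = Suc (matching_size ds)"
  by (auto simp: matching_size_def)

text \<open>The invariant of a branch, with \<open>us ! j\<close> the optimal partner of online
  vertex \<open>j\<close>: of this pair at most one endpoint is covered. The cardinality equation
  says that no offline vertex is chosen twice.\<close>

definition half_blocked :: "nat set \<Rightarrow> nat list \<Rightarrow> nat option list \<Rightarrow> bool" where
  "half_blocked U us ds \<longleftrightarrow> length ds = length us \<and> filled ds \<subseteq> U \<and>
     card (filled ds) = matching_size ds \<and>
     (\<forall>j < length us. ds ! j \<noteq> None \<longrightarrow> us ! j \<notin> filled ds)"

lemma half_blocked_snoc_None:
  "half_blocked U us ds \<Longrightarrow> half_blocked U (us @ [u]) (ds @ [None])"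
  by (auto simp: half_blocked_def nth_append less_Suc_eq)

text \<open>\<open>x \<notin> set us\<close> keeps all earlier partners as they were, and the last
  two hypotheses leave the new partner \<open>u\<close> unfilled.\<close>

lemma half_blocked_snoc_Some:
  assumes "half_blocked U us ds" "x \<in> U" "x \<notin> filled ds" "x \<notin> set us"
    and "u \<noteq> x" "u \<notin> filled ds"
  shows "half_blocked U (us @ [u]) (ds @ [Some x])"
  using assms by (auto simp: half_blocked_def nth_append less_Suc_eq)

text \<open>The offline vertices filled by a branch and the partners of its matched online vertices
  are disjoint subsets of \<open>U\<close>, each of size \<open>matching_size ds\<close>.\<close>

lemma matching_size_half_blocked:
  assumes "half_blocked U us ds" "finite U" "set us \<subseteq> U" "distinct us"
  shows "2 * matching_size ds \<le> card U"
proof -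
  let ?n = "length us"
  let ?M = "{j. j < ?n \<and> ds ! j \<noteq> None}"
  have len: "length ds = ?n" and card: "card (filled ds) = matching_size ds"
    and sub: "filled ds \<subseteq> U"
    and half: "\<And>j. j < ?n \<Longrightarrow> ds ! j \<noteq> None \<Longrightarrow> us ! j \<notin> filled ds"
    using assms(1) by (auto simp: half_blocked_def)
  have "inj_on ((!) us) ?M"
    using assms(4) by (auto simp: inj_on_def nth_eq_iff_index_eq)
  then have "card ((!) us ` ?M) = matching_size ds"
    by (simp add: card_image matching_size_def length_filter_conv_card len)
  moreover have "filled ds \<inter> (!) us ` ?M = {}"
    using half by auto
  ultimately have "card (filled ds \<union> (!) us ` ?M) = 2 * matching_size ds"
    by (subst card_Un_disjoint) (auto simp: card)
  moreover have "filled ds \<union> (!) us ` ?M \<subseteq> U"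
    using sub assms(3) by auto
  ultimately show ?thesis
    using card_mono[OF assms(2)] by metis
qed

lemma adversary_step:
  assumes A: "width_alg k A" and wf: "wf_instance (U, ns)"
    and len: "length us = length ns" and us: "set us \<subseteq> U" "distinct us"
    and half: "\<And>ds. ds \<in> set (tree_level A U ns (length ns)) \<Longrightarrow> half_blocked U us ds"
    and large: "length ns + k * 2 ^ Suc k < card U"
  obtains N u where "N \<subseteq> U" "u \<in> N" "u \<notin> set us"
    "\<And>ds. ds \<in> set (tree_level A U (ns @ [N]) (Suc (length ns))) \<Longrightarrow> half_blocked U (us @ [u]) ds"
proof -
  define L where "L = tree_level A U ns (length ns)"
  define R where "R = U - set us"
  \<comment> \<open>The signature of a pool vertex: the nodes that fill it. There are at most
    \<open>2 ^ Suc k\<close> signatures, so a pool of more than \<open>k * 2 ^ Suc k\<close>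
    vertices has a fibre of more than \<open>k\<close>.\<close>
  define g where "g r = {ds \<in> set L. r \<in> filled ds}" for r
  have U: "finite U" using wf by (simp add: wf_instance_def)
  have "card (set L) \<le> Suc k"
    using length_tree_level_le[OF A wf, of "length ns"] card_length[of L] unfolding L_def by simp
  then have "card (Pow (set L)) \<le> 2 ^ Suc k"
    unfolding card_Pow[OF finite_set] by (intro power_increasing) auto
  moreover have "card R > k * 2 ^ Suc k"
    using large us len unfolding R_def by (simp add: card_Diff_subset distinct_card)
  ultimately have "card R > k * card (Pow (set L))"
    by (meson le_less_trans mult_le_mono2)
  moreover obtain b where "card R \<le> card (g -` {b} \<inter> R) * card (Pow (set L))"
    using pigeonhole_card[of g R "Pow (set L)"] U by (auto simp: R_def g_def)
  ultimately have b: "card (g -` {b} \<inter> R) > k"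
    by (meson le_less_trans less_le_trans mult_less_cancel2)
  define N where "N = g -` {b} \<inter> R"
  have NU: "N \<subseteq> U" "N \<inter> set us = {}" by (auto simp: N_def R_def)
  have wf': "wf_instance (U, ns @ [N])"
    using wf NU by (auto simp: wf_instance_def)
  define C where "C = A U (ns @ [N])"
  have L': "tree_level A U (ns @ [N]) (length ns) = L"
    by (simp add: L_def tree_level_append)
  have C: "length C \<le> k" "\<And>p d. (p, d) \<in> set C \<Longrightarrow> p < length L"
    "\<And>p x. (p, Some x) \<in> set C \<Longrightarrow> x \<in> N \<and> Some x \<notin> set (L ! p)"
    using width_algD[OF A wf', of "length ns"] by (auto simp: C_def L')
  \<comment> \<open>At most \<open>k\<close> children choose at most one vertex each, so some vertex
    of \<open>N\<close> is chosen by none of them.\<close>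
  have "card (Some -` snd ` set C) \<le> card (snd ` set C)"
    using card_vimage_inj_on_le[of Some UNIV "snd ` set C"] by simp
  also have "\<dots> \<le> k"
    using C(1) by (meson card_image_le card_length finite_set le_trans)
  finally have "\<not> N \<subseteq> Some -` snd ` set C"
    using b card_mono[of "Some -` snd ` set C" N] finite_vimageI[of "snd ` set C" Some]
    unfolding N_def by fastforce
  then obtain u where u: "u \<in> N" "\<And>p. (p, Some u) \<notin> set C"
    by force
  show thesis
  proof (rule that[OF NU(1) u(1)])
    show "u \<notin> set us" using u NU by auto
    fix ds assume "ds \<in> set (tree_level A U (ns @ [N]) (Suc (length ns)))"
    then obtain p d where pd: "(p, d) \<in> set C" "ds = L ! p @ [d]"
      by (auto simp: L' C_def)
    have e: "L ! p \<in> set L" using C(2) pd by simp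
    then have hb: "half_blocked U us (L ! p)" using half by (simp add: L_def)
    show "half_blocked U (us @ [u]) ds"
    proof (cases d)
      case None
      then show ?thesis using half_blocked_snoc_None[OF hb] pd by simp
    next
      case (Some x)
      then have x: "x \<in> N" "x \<notin> filled (L ! p)" "x \<noteq> u"
        using C(3)[of p x] pd u by (auto simp: filled_def)
      \<comment> \<open>The parent does not fill \<open>x\<close>, and \<open>u\<close> has the same
        signature, so the parent does not fill \<open>u\<close> either.\<close>
      have "g u = g x" using x u by (simp add: N_def)
      then have "u \<notin> filled (L ! p)" using x e by (auto simp: g_def)
      moreover have "x \<in> U" "x \<notin> set us" using x(1) NU by auto
      ultimately show ?thesis
        using half_blocked_snoc_Some[OF hb, of x u] x Some pd by simp
    qed
  qed
qed

text \<open>Each round removes one vertex from the pool, so before each of the \<open>n\<close>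
  rounds more than \<open>k * 2 ^ Suc k\<close> vertices remain and \<open>adversary_step\<close>
  applies.\<close>

lemma adversary:
  assumes A: "width_alg k A" and U: "finite U" and large: "n + k * 2 ^ Suc k \<le> card U"
  obtains ns us where "wf_instance (U, ns)" "length ns = n" "length us = n"
    "set us \<subseteq> U" "distinct us" "\<And>j. j < n \<Longrightarrow> us ! j \<in> ns ! j"
    "\<And>ds. ds \<in> set (tree_level A U ns n) \<Longrightarrow> half_blocked U us ds"
proof -
  have "\<exists>ns us. wf_instance (U, ns) \<and> length ns = n \<and> length us = n \<and>
    set us \<subseteq> U \<and> distinct us \<and> (\<forall>j < n. us ! j \<in> ns ! j) \<and>
    (\<forall>ds \<in> set (tree_level A U ns n). half_blocked U us ds)"
    using large
  proof (induction n)
    case 0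
    then show ?case
      using U by (simp add: wf_instance_def half_blocked_def)
  next
    case (Suc n)
    then obtain ns us where *: "wf_instance (U, ns)" "length ns = n" "length us = n"
      "set us \<subseteq> U" "distinct us" "\<forall>j < n. us ! j \<in> ns ! j"
      "\<And>ds. ds \<in> set (tree_level A U ns n) \<Longrightarrow> half_blocked U us ds"
      by auto
    obtain N u where "N \<subseteq> U" "u \<in> N" "u \<notin> set us"
      "\<And>ds. ds \<in> set (tree_level A U (ns @ [N]) (Suc n)) \<Longrightarrow> half_blocked U (us @ [u]) ds"
      using adversary_step[OF A *(1), of us] * Suc.prems by auto
    with * show ?case
      by (intro exI[of _ "ns @ [N]"] exI[of _ "us @ [u]"])
        (auto simp: wf_instance_def nth_append less_Suc_eq simp del: tree_level.simps)
  qed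
  with that show thesis by blast
qed

text \<open>Distinct partners make the edges \<open>(j, us ! j)\<close> a matching that covers all
  online vertices.\<close>

lemma length_le_opt_value:
  assumes wf: "wf_instance (U, ns)" and len: "length us = length ns" and "distinct us"
    and "\<And>j. j < length ns \<Longrightarrow> us ! j \<in> ns ! j"
  shows "length ns \<le> opt_value (U, ns)"
proof -
  let ?M = "(\<lambda>j. (j, us ! j)) ` {..<length ns}"
  \<comment> \<open>All matchings live in one finite set, so there are finitely many and
    \<open>Max\<close> bounds each of their sizes.\<close>
  have "M \<subseteq> {..<length ns} \<times> U" if "is_matching ns M" for M
    using that wf nth_mem unfolding is_matching_def wf_instance_def by fastforce
  moreover have "finite ({..<length ns} \<times> U)"
    using wf by (simp add: wf_instance_def)
  ultimately have "{M. is_matching ns M} \<subseteq> Pow ({..<length ns} \<times> U)" "finite (Pow ({..<length ns} \<times> U))"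
    by blast+
  then have "finite {M. is_matching ns M}"
    by (rule finite_subset)
  then have "finite {card M | M. is_matching ns M}"
    by simp
  moreover have "is_matching ns ?M"
    using assms by (auto simp: is_matching_def nth_eq_iff_index_eq)
  moreover have "card ?M = length ns"
    by (simp add: card_image inj_on_def)
  ultimately show ?thesis
    unfolding opt_value_def snd_conv by (intro Max_ge) force+
qed

lemma Inf_inst_ratio_le:
  assumes A: "width_alg k A" and n: "n > 0"
  shows "(INF I \<in> instances_of_size n. ereal (inst_ratio A I))
    \<le> ereal (1/2 + real (k * 2 ^ Suc k) / 2 / real n)"
proof -
  \<comment> \<open>The smallest size that lets the adversary last \<open>n\<close> rounds; half of
    the surplus over \<open>n\<close> becomes the error term.\<close>
  define U where "U = {..<n + k * 2 ^ Suc k}"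
  have U: "finite U" "card U = n + k * 2 ^ Suc k" by (auto simp: U_def)
  then obtain ns us where wf: "wf_instance (U, ns)" and len: "length ns = n" "length us = n"
    and us: "set us \<subseteq> U" "distinct us" "\<And>j. j < n \<Longrightarrow> us ! j \<in> ns ! j"
    and half: "\<And>ds. ds \<in> set (tree_level A U ns n) \<Longrightarrow> half_blocked U us ds"
    using adversary[OF A, of U n] by auto
  have opt: "n \<le> opt_value (U, ns)"
    using length_le_opt_value[OF wf, of us] len us by simp
  have "alg_value A (U, ns) \<in> matching_size ` set (tree_level A U ns n)"
    unfolding alg_value_def fst_conv snd_conv len
    using tree_level_nonempty[OF A wf, of n] len by (intro Max_in) auto
  then have alg: "2 * alg_value A (U, ns) \<le> n + k * 2 ^ Suc k"
    using matching_size_half_blocked[OF half U(1) us(1,2)] U(2) by auto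
  have "inst_ratio A (U, ns) = real (alg_value A (U, ns)) / real (opt_value (U, ns))"
    using opt n by (simp add: inst_ratio_def)
  also have "\<dots> \<le> real (alg_value A (U, ns)) / real n"
    using opt n by (intro divide_left_mono) auto
  also have "\<dots> \<le> (real (n + k * 2 ^ Suc k) / 2) / real n"
    using alg by (intro divide_right_mono) (simp_all flip: of_nat_le_iff[where 'a = real])
  also have "\<dots> = 1/2 + real (k * 2 ^ Suc k) / 2 / real n"
    using n by (simp add: field_simps)
  finally have "inst_ratio A (U, ns) \<le> 1/2 + real (k * 2 ^ Suc k) / 2 / real n" .
  moreover have "(U, ns) \<in> instances_of_size n"
    using wf len by (simp add: instances_of_size_def inst_size_def)
  ultimately show ?thesis
    by (intro INF_lower2) auto
qed

theorem theorem6: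
  fixes k :: nat and A :: algorithm
  assumes "width_alg k A"
  shows "asymptotic_ratio A \<le> ereal (1/2)"
proof -
  let ?f = "\<lambda>n. ereal (1/2 + real (k * 2 ^ Suc k) / 2 / real n)"
  have "(\<lambda>n. 1/2 + real (k * 2 ^ Suc k) / 2 / real n) \<longlonglongrightarrow> 1/2 + 0"
    by (intro tendsto_add tendsto_const lim_const_over_n)
  then have "?f \<longlonglongrightarrow> ereal (1/2)"
    by simp
  then have "liminf ?f = ereal (1/2)"
    by (intro lim_imp_Liminf) auto
  \<comment> \<open>The bound on the infimum is available for \<open>n > 0\<close>, and the limit
    inferior needs it only eventually.\<close>
  moreover have "asymptotic_ratio A \<le> liminf ?f"
    unfolding asymptotic_ratio_def
    by (intro Liminf_mono eventually_mono[OF eventually_gt_at_top[of 0]] Inf_inst_ratio_le[OF assms])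
  ultimately show ?thesis by simp
qed

end
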